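(* Let $p,q$ be coprime integers with $|p|+|q|>2$, let $n\ge 1$, and let $A\in\mathcal{M}_n(\mathbb{C})$ be such that $(m\sigma(A))^p=(m\sigma(A))^q$ (equality of multisets). i) Suppose $A$ is invertible. Let $\lambda_1,\dots,\lambda_m$ be the distinct eigenvalues of $A$, with algebraic multiplicities $i_1,\dots,i_m$, and write the Jordan normal form of $A$ as $A=P\,\mathrm{diag}(\lambda_1I_{i_1}+N_1,\dots,\lambda_mI_{i_m}+N_m)P^{-1}$ with $P$ invertible and each $N_k$ a nilpotent Jordan matrix (a block-diagonal matrix of nilpotent Jordan blocks). Let $O_1,\dots,O_\tau$ be the distinct orbits of $\sigma(A)$ and $r_1,\dots,r_\tau$ their multiplicities (see context). Then $A^p$ and $A^q$ are similar if and only if for every $j\le\tau$ and all $\lambda_k,\lambda_l\in O_j$ one has $i_k=i_l=r_j$ and $N_k=N_l$ up to the ordering of the nilpotent Jordan blocks contained in $N_k$ and $N_l$. ii) Suppose $A$ is not invertible and $1\le p<q$. Then $A^p$ and $A^q$ are similar if and only if there exist $k$ with $1\le k\le n$, an invertible matrix $P$, a matrix $A'\in GL_{n-k}(\mathbb{C})$ and a matrix $N\in\mathcal{M}_k(\mathbb{C})$ such that $A=P\,\mathrm{diag}(A',N)P^{-1}$, $N^p=0_k$, and $A'$ satisfies the condition given in i) (that is, $(m\sigma(A'))^p=(m\sigma(A'))^q$, and for any two eigenvalues of $A'$ in the same orbit, the multiplicities both equal the multiplicity of the orbit and the nilpotent Jordan parts coincide up to ordering of blocks). When $k=n$ the block $A'$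 is absent.
   Context: $\sigma(A)$ is the set of distinct eigenvalues of $A$; $m\sigma(A)$ is the multiset of eigenvalues of $A$ counted with algebraic multiplicity. For a multiset $U$ of complex numbers and $p\in\mathbb{Z}$ (with $0\notin U$ if $p<0$), $U^p$ is the multiset of $p$-th powers of the elements of $U$, with multiplicities. Orbits: if $A$ is invertible and $(m\sigma(A))^p=(m\sigma(A))^q$, then for every $\lambda\in\sigma(A)$ there is a unique $\pi(\lambda)\in\sigma(A)$ with $\lambda^q=\pi(\lambda)^p$, and $\pi$ is a permutation of $\sigma(A)$. The orbits are the orbits of $\pi$ (i.e. of the corresponding action of $\mathbb{Z}$) on $\sigma(A)$. All elements of an orbit have the same multiplicity in $m\sigma(A)$, and this common value is called the multiplicity of the orbit. *)

theory Defs
  imports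
    Jordan_Normal_Form.Spectral_Radius
    Jordan_Normal_Form.Gauss_Jordan_Elimination
begin

text \<open>The set of distinct eigenvalues of \<open>A\<close> is the library's \<open>spectrum A\<close>. Multiplicities are
  algebraic, i.e. root multiplicities of the characteristic polynomial.\<close>

definition eigenvalue_mset :: "complex mat \<Rightarrow> complex multiset" where
  "eigenvalue_mset A = proots (char_poly A)"

text \<open>As \<open>0 powi p = 0\<close> for negative \<open>p\<close>, the following two definitions are meaningful for
  negative exponents only if \<open>0 \<notin># U\<close>, respectively if \<open>A\<close> is invertible.\<close>

definition mset_powi :: "complex multiset \<Rightarrow> int \<Rightarrow> complex multiset" where
  "mset_powi U p = image_mset (\<lambda>x. x powi p) U"

definition mat_powi :: "complex mat \<Rightarrow> int \<Rightarrow> complex mat" where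
  "mat_powi A p = (if p \<ge> 0 then A ^\<^sub>m nat p else the (mat_inverse A) ^\<^sub>m nat (- p))"

text \<open>The permutation \<open>\<pi>\<close> of the spectrum with \<open>\<lambda>\<^sup>q = (\<pi> \<lambda>)\<^sup>p\<close>. The description is proper when \<open>A\<close> is
  invertible, \<open>p\<close> and \<open>q\<close> are coprime with \<open>\<bar>p\<bar> + \<bar>q\<bar> > 2\<close>, and the \<open>p\<close>-th and \<open>q\<close>-th powers of the
  eigenvalue multiset coincide. The value at a non-eigenvalue is irrelevant.\<close>

definition eigen_perm :: "int \<Rightarrow> int \<Rightarrow> complex mat \<Rightarrow> complex \<Rightarrow> complex" where
  "eigen_perm p q A x = (THE y. y \<in> spectrum A \<and> x powi q = y powi p)"

text \<open>Orbits of the action of the integers: \<open>y = \<pi>\<^sup>k x\<close> for an integer \<open>k\<close>, where for negative \<open>k\<close>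
  this is written as \<open>x = \<pi>\<^bsup>-k\<^esup> y\<close>.\<close>

definition eigen_orbit :: "int \<Rightarrow> int \<Rightarrow> complex mat \<Rightarrow> complex \<Rightarrow> complex set" where
  "eigen_orbit p q A x = {y \<in> spectrum A.
     \<exists>k::nat. y = (eigen_perm p q A ^^ k) x \<or> x = (eigen_perm p q A ^^ k) y}"

definition eigen_orbits :: "int \<Rightarrow> int \<Rightarrow> complex mat \<Rightarrow> complex set set" where
  "eigen_orbits p q A = eigen_orbit p q A ` spectrum A"

definition orbit_multiplicity :: "complex mat \<Rightarrow> complex set \<Rightarrow> nat" where
  "orbit_multiplicity A X = (THE r. \<forall>x\<in>X. count (eigenvalue_mset A) x = r)"

definition nilpotent_jordan :: "nat list \<Rightarrow> complex mat" where
  "nilpotent_jordan bs = jordan_matrix (map (\<lambda>b. (b, 0)) bs)"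

definition is_nilpotent_jordan :: "complex mat \<Rightarrow> bool" where
  "is_nilpotent_jordan N \<longleftrightarrow> (\<exists>bs. 0 \<notin> set bs \<and> N = nilpotent_jordan bs)"

definition eq_up_to_block_order :: "complex mat \<Rightarrow> complex mat \<Rightarrow> bool" where
  "eq_up_to_block_order N N' \<longleftrightarrow> (\<exists>bs bs'. 0 \<notin> set bs \<and> 0 \<notin> set bs' \<and>
     N = nilpotent_jordan bs \<and> N' = nilpotent_jordan bs' \<and> mset bs = mset bs')"

text \<open>The Jordan normal form grouped by eigenvalue: \<open>lams\<close> enumerates the distinct eigenvalues,
  \<open>mults\<close> their multiplicities, \<open>Ns\<close> the nilpotent parts, and
  \<open>A = P diag(\<lambda>\<^sub>1 I + N\<^sub>1, \<dots>, \<lambda>\<^sub>m I + N\<^sub>m) Q\<close> where \<open>Q\<close> is the inverse of \<open>P\<close>.\<close>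

definition grouped_jordan_form ::
  "complex mat \<Rightarrow> complex list \<Rightarrow> nat list \<Rightarrow> complex mat list \<Rightarrow> complex mat \<Rightarrow> complex mat \<Rightarrow> bool"
where
  "grouped_jordan_form A lams mults Ns P Q \<longleftrightarrow>
     distinct lams \<and> set lams = spectrum A \<and>
     mults = map (count (eigenvalue_mset A)) lams \<and>
     length Ns = length lams \<and>
     (\<forall>k < length lams. Ns ! k \<in> carrier_mat (mults ! k) (mults ! k) \<and>
        is_nilpotent_jordan (Ns ! k)) \<and>
     similar_mat_wit A
       (diag_block_mat
         (map (\<lambda>k. lams ! k \<cdot>\<^sub>m 1\<^sub>m (mults ! k) + Ns ! k) [0..<length lams]))
       P Q"

definition orbit_condition ::
  "int \<Rightarrow> int \<Rightarrow> complex mat \<Rightarrow> complex list \<Rightarrow> nat list \<Rightarrow> complex mat list \<Rightarrow> bool"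
where
  "orbit_condition p q A lams mults Ns \<longleftrightarrow>
     (\<forall>X \<in> eigen_orbits p q A. \<forall>k < length lams. \<forall>l < length lams.
        lams ! k \<in> X \<longrightarrow> lams ! l \<in> X \<longrightarrow>
          mults ! k = orbit_multiplicity A X \<and> mults ! l = orbit_multiplicity A X \<and>
          eq_up_to_block_order (Ns ! k) (Ns ! l))"

end

theory Submission
  imports Defs Jordan_Normal_Form.Jordan_Normal_Form_Uniqueness
begin

text \<open>The Jordan normal form is unique as a multiset of blocks, and for \<open>p \<noteq> 0\<close> the \<open>p\<close>-th power of
  an invertible matrix turns a block \<open>(b, \<lambda>)\<close> into \<open>(b, \<lambda>\<^sup>p)\<close>. Hence \<open>A\<^sup>p\<close> and \<open>A\<^sup>q\<close> are similar iff
  the block multisets with eigenvalues raised to the powers \<open>p\<close> and \<open>q\<close> agree. As the spectrum \<open>S\<close>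
  satisfies \<open>S\<^sup>p = S\<^sup>q\<close>, it consists of roots of unity of order coprime to \<open>p\<close> and \<open>q\<close>, so both power
  maps are injective on \<open>S\<close>, and agreement of the block multisets says that the number of blocks of
  each size is invariant under \<open>\<pi>\<close>, that is, constant on orbits. A singular matrix splits into an
  invertible and a nilpotent part; comparing the kernels of \<open>A\<^sup>p\<close> and \<open>A\<^sup>q\<close> shows that the nilpotent
  blocks have size at most \<open>p\<close>, and then the nilpotent part contributes the same zero blocks to
  both powers.\<close>

subsection \<open>Uniqueness of the Jordan normal form as a multiset of blocks\<close>

text \<open>Conjugation by the block permutation matrix \<open>?P\<close>, with inverse
  \<open>?Q\<close>, exchanges the two diagonal blocks.\<close>

lemma similar_mat_four_block_swap:
  fixes A B :: "'a :: comm_ring_1 mat"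
  assumes A: "A \<in> carrier_mat n n" and B: "B \<in> carrier_mat m m"
  shows "similar_mat (four_block_mat A (0\<^sub>m n m) (0\<^sub>m m n) B)
    (four_block_mat B (0\<^sub>m m n) (0\<^sub>m n m) A)"
proof -
  let ?P = "four_block_mat (0\<^sub>m n m) (1\<^sub>m n) (1\<^sub>m m) (0\<^sub>m m n) :: 'a mat"
  let ?Q = "four_block_mat (0\<^sub>m m n) (1\<^sub>m m) (1\<^sub>m n) (0\<^sub>m n m) :: 'a mat"
  let ?A = "four_block_mat A (0\<^sub>m n m) (0\<^sub>m m n) B"
  let ?B = "four_block_mat B (0\<^sub>m m n) (0\<^sub>m n m) A"
  have PB: "?P * ?B = four_block_mat (0\<^sub>m n m) A B (0\<^sub>m m n)"
    using A B by (subst mult_four_block_mat[of _ n m _ n _ m _ _ m _ n]) auto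
  have "?P * ?B * ?Q = ?A"
    unfolding PB using A B
    by (subst mult_four_block_mat[of _ n m _ n _ m _ _ n _ m]) auto
  moreover have "?P * ?Q = 1\<^sub>m (n + m)"
    by (subst mult_four_block_mat[of _ n m _ n _ m _ _ n _ m]) auto
  moreover have "?Q * ?P = 1\<^sub>m (n + m)"
    by (subst mult_four_block_mat[of _ m n _ m _ n _ _ m _ n]) (auto simp: add.commute)
  moreover have "?P \<in> carrier_mat (n + m) (n + m)" "?Q \<in> carrier_mat (n + m) (n + m)"
    "?B \<in> carrier_mat (n + m) (n + m)" "?A \<in> carrier_mat (n + m) (n + m)"
    using A B by (auto intro!: carrier_matI)
  ultimately show ?thesis
    unfolding similar_mat_def using similar_mat_witI by metis
qed

lemma jordan_matrix_append:
  "jordan_matrix (as @ bs) = four_block_mat (jordan_matrix as)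
     (0\<^sub>m (sum_list (map fst as)) (sum_list (map fst bs)))
     (0\<^sub>m (sum_list (map fst bs)) (sum_list (map fst as))) (jordan_matrix bs)"
proof -
  have "jordan_matrix (as @ bs) = diag_block_mat (map (\<lambda>(n, a). jordan_block n a) as
      @ map (\<lambda>(n, a). jordan_block n a) bs)"
    by (simp add: jordan_matrix_def)
  then show ?thesis
    unfolding diag_block_mat_append Let_def jordan_matrix_def[symmetric] by simp
qed

lemma similar_mat_jordan_matrix_append_commute:
  fixes as :: "(nat \<times> 'a :: comm_ring_1) list"
  shows "similar_mat (jordan_matrix (as @ bs)) (jordan_matrix (bs @ as))"
  unfolding jordan_matrix_append by (rule similar_mat_four_block_swap) auto

lemma similar_mat_jordan_matrix_append_cong:
  fixes as :: "(nat \<times> 'a :: comm_ring_1) list"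
  assumes "similar_mat (jordan_matrix as) (jordan_matrix as')"
    and "similar_mat (jordan_matrix bs) (jordan_matrix bs')"
  shows "similar_mat (jordan_matrix (as @ bs)) (jordan_matrix (as' @ bs'))"
proof -
  have "sum_list (map fst as') = sum_list (map fst as)"
    "sum_list (map fst bs') = sum_list (map fst bs)"
    using similar_matD[OF assms(1)] similar_matD[OF assms(2)] by (metis carrier_matD(1)
        insert_subset jordan_matrix_dim(1))+
  then show ?thesis
    unfolding jordan_matrix_append
    using similar_mat_four_block_0_0[OF assms jordan_matrix_carrier jordan_matrix_carrier] by simp
qed

text \<open>Swapping two consecutive sublists suffices: the head block \<open>a\<close> is located
  in \<open>bs = xs @ a # ys\<close>, which is rotated to \<open>a # ys @ xs\<close>, and the
  induction hypothesis handles the tail.\<close>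

lemma similar_mat_jordan_matrix_mset:
  fixes as :: "(nat \<times> 'a :: comm_ring_1) list"
  assumes "mset as = mset bs"
  shows "similar_mat (jordan_matrix as) (jordan_matrix bs)"
  using assms
proof (induction as arbitrary: bs)
  case Nil
  then show ?case by (auto intro: similar_mat_refl[OF jordan_matrix_carrier])
next
  case (Cons a as)
  have "a \<in> set bs" using Cons.prems by (metis list.set_intros(1) set_mset_mset)
  then obtain xs ys where bs: "bs = xs @ a # ys" by (meson split_list)
  have "similar_mat (jordan_matrix as) (jordan_matrix (ys @ xs))"
    using Cons.prems by (intro Cons.IH) (simp add: bs)
  from similar_mat_jordan_matrix_append_cong[OF similar_mat_refl[OF jordan_matrix_carrier] this]
  have "similar_mat (jordan_matrix (a # as)) (jordan_matrix ((a # ys) @ xs))"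
    by (metis append_Cons append_Nil)
  also note similar_mat_jordan_matrix_append_commute
  finally (similar_mat_trans) show ?case by (simp add: bs)
qed

text \<open>The number of blocks of positive size \<open>k\<close> for \<open>e\<close> is a
  function of dimensions of generalized eigenspaces, which depend on \<open>A\<close> alone. Blocks
  of size 0 are excluded by \<open>jordan_nf\<close>.\<close>

lemma jordan_nf_mset_unique:
  fixes A :: "'a :: field mat"
  assumes "jordan_nf A as" "jordan_nf A bs"
  shows "mset as = mset bs"
proof (rule multiset_eqI)
  fix x :: "nat \<times> 'a"
  obtain k e where x: "x = (k, e)" by force
  show "count (mset as) x = count (mset bs) x"
  proof (cases "k = 0")
    case True
    then have "x \<notin> set as" "x \<notin> set bs"
      using assms by (auto simp: jordan_nf_def x image_iff)
    then show ?thesis by (metis count_inI set_mset_mset)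
  next
    case False
    then show ?thesis
      using compute_nr_of_jordan_blocks[OF assms(1) False, of e]
        compute_nr_of_jordan_blocks[OF assms(2) False, of e]
      by (simp add: count_mset count_list_eq_length_filter x)
  qed
qed

lemma similar_mat_iff_jordan_nf_mset:
  fixes A :: "'a :: field mat"
  assumes "jordan_nf A as" "jordan_nf B bs"
  shows "similar_mat A B \<longleftrightarrow> mset as = mset bs"
proof
  assume "similar_mat A B"
  then have "jordan_nf A bs"
    using assms(2) similar_mat_trans unfolding jordan_nf_def by blast
  then show "mset as = mset bs" by (rule jordan_nf_mset_unique[OF assms(1)])
next
  assume "mset as = mset bs"
  from similar_mat_jordan_matrix_mset[OF this] assms show "similar_mat A B"
    unfolding jordan_nf_def using similar_mat_trans similar_mat_sym by blast
qed

subsection \<open>Jordan normal forms of powers and inverses\<close>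

lemma pow_mat_Suc_left:
  fixes A :: "'a :: semiring_1 mat"
  assumes A: "A \<in> carrier_mat n n"
  shows "A ^\<^sub>m Suc k = A * A ^\<^sub>m k"
proof (induction k)
  case (Suc k)
  have "A ^\<^sub>m Suc (Suc k) = (A * A ^\<^sub>m k) * A"
    using Suc by simp
  also have "\<dots> = A * A ^\<^sub>m Suc k"
    using A by (simp add: assoc_mult_mat[OF A pow_carrier_mat[OF A] A])
  finally show ?case .
qed (use A in simp)

section \<open>Criteria for similarity to a single Jordan block\<close>

lemma pow_strictly_upper_triangular:
  fixes C :: "'a :: idom mat"
  assumes C: "C \<in> carrier_mat n n"
    and low: "\<And>i j. i < n \<Longrightarrow> j \<le> i \<Longrightarrow> C $$ (i, j) = 0"
    and sup: "\<And>i. Suc i < n \<Longrightarrow> C $$ (i, Suc i) \<noteq> 0"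
    and i: "i < n" and j: "j < n"
  shows "j < i + k \<Longrightarrow> (C ^\<^sub>m k) $$ (i, j) = 0"
    and "j = i + k \<Longrightarrow> (C ^\<^sub>m k) $$ (i, j) \<noteq> 0"
proof -
  \<comment> \<open>Each further factor moves the lowest nonzero diagonal up by one, and its entries
    are products of superdiagonal entries of \<open>C\<close>. Both claims are proved together
    because each step uses both.\<close>
  have "(j < i + k \<longrightarrow> (C ^\<^sub>m k) $$ (i, j) = 0) \<and> (j = i + k \<longrightarrow> (C ^\<^sub>m k) $$ (i, j) \<noteq> 0)"
    using j
  proof (induction k arbitrary: j)
    case 0
    then show ?case using C i by auto
  next
    case (Suc k)
    have Ck: "C ^\<^sub>m k \<in> carrier_mat n n" using C by simp
    have expand: "(C ^\<^sub>m Suc k) $$ (i, j) = (\<Sum>l = 0..<n. (C ^\<^sub>m k) $$ (i, l) * C $$ (l, j))"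
      using C Ck i Suc.prems by (auto simp: scalar_prod_def)
    \<comment> \<open>Either \<open>l < i + k\<close>, where the first factor vanishes, or
      \<open>j \<le> l\<close>, where the second one does.\<close>
    have zero: "(C ^\<^sub>m k) $$ (i, l) * C $$ (l, j) = 0"
      if "l < n" "j \<le> i + Suc k" "l \<noteq> i + k \<or> j < i + Suc k" for l
      using that Suc.IH[of l] low[of l j] Suc.prems by (cases "l < i + k") auto
    show ?case
    proof (intro conjI impI)
      assume "j < i + Suc k"
      then show "(C ^\<^sub>m Suc k) $$ (i, j) = 0"
        unfolding expand using zero by (intro sum.neutral) auto
    next
      assume j: "j = i + Suc k"
      have "(C ^\<^sub>m Suc k) $$ (i, j) = (C ^\<^sub>m k) $$ (i, i + k) * C $$ (i + k, j)"
      proof -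
        have "(\<Sum>l \<in> {0..<n} - {i + k}. (C ^\<^sub>m k) $$ (i, l) * C $$ (l, j)) = 0"
          by (intro sum.neutral ballI zero) (use j in auto)
        then show ?thesis
          unfolding expand using j Suc.prems by (subst sum.remove[of _ "i + k"]) auto
      qed
      then show "(C ^\<^sub>m Suc k) $$ (i, j) \<noteq> 0"
        using Suc.IH[of "i + k"] sup[of "i + k"] j Suc.prems by simp
    qed
  qed
  then show "j < i + k \<Longrightarrow> (C ^\<^sub>m k) $$ (i, j) = 0"
    and "j = i + k \<Longrightarrow> (C ^\<^sub>m k) $$ (i, j) \<noteq> 0" by auto
qed

lemma similar_mat_nilpotent_jordan_block:
  fixes C :: "'a :: field mat"
  assumes C: "C \<in> carrier_mat n n"
    and low: "\<And>i j. i < n \<Longrightarrow> j \<le> i \<Longrightarrow> C $$ (i, j) = 0"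
    and sup: "\<And>i. Suc i < n \<Longrightarrow> C $$ (i, Suc i) \<noteq> 0"
  shows "similar_mat C (jordan_block n 0)"
proof -
  have pow: "j < i + k \<Longrightarrow> (C ^\<^sub>m k) $$ (i, j) = 0" "j = i + k \<Longrightarrow> (C ^\<^sub>m k) $$ (i, j) \<noteq> 0"
    if "i < n" "j < n" for i j k
    using pow_strictly_upper_triangular[of C n i j k] assms that by blast+
  \<comment> \<open>The columns of \<open>P\<close> are the Jordan chain \<open>C\<^sup>n\<^sup>-\<^sup>1 e, \<dots>, C e, e\<close> with \<open>e\<close> the last unit vector;
    \<open>P\<close> is upper triangular with nonzero diagonal.\<close>
  define P where "P = mat n n (\<lambda>(i, j). (C ^\<^sub>m (n - 1 - j)) $$ (i, n - 1))"
  have P: "P \<in> carrier_mat n n" by (simp add: P_def)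
  have "upper_triangular P" using pow(1) by (auto simp: P_def)
  then have "det P = prod_list (diag_mat P)" using P by (rule det_upper_triangular)
  moreover have "0 \<notin> set (diag_mat P)"
  proof -
    have "P $$ (i, i) \<noteq> 0" if "i < n" for i
      using pow(2)[of i "n - 1" "n - 1 - i"] that by (simp add: P_def)
    then show ?thesis using P by (force simp: diag_mat_def)
  qed
  ultimately have "det P \<noteq> 0" by (simp add: prod_list_zero_iff)
  from det_non_zero_imp_unit[OF P this] obtain Q where Q: "Q \<in> carrier_mat n n"
    and PQ: "P * Q = 1\<^sub>m n" and QP: "Q * P = 1\<^sub>m n"
    unfolding Units_def by (auto simp: ring_mat_def)
  have J: "jordan_block n 0 \<in> carrier_mat n n" by simp
  have "C * P = P * jordan_block n 0"
  proof (rule eq_matI)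
    fix i j assume "i < dim_row (P * jordan_block n 0)" "j < dim_col (P * jordan_block n 0)"
    then have i: "i < n" and j: "j < n" using P by auto
    have "(C * P) $$ (i, j) = (C * C ^\<^sub>m (n - 1 - j)) $$ (i, n - 1)"
      using C P i j by (auto simp: scalar_prod_def P_def)
    also have "C * C ^\<^sub>m (n - 1 - j) = C ^\<^sub>m (n - j)"
      using C j by (metis One_nat_def Suc_diff_Suc diff_Suc_eq_diff_pred pow_mat_Suc_left)
    finally have CP: "(C * P) $$ (i, j) = (C ^\<^sub>m (n - j)) $$ (i, n - 1)" .
    have PJ: "(P * jordan_block n 0) $$ (i, j) = (\<Sum>l = 0..<n. if Suc l = j then P $$ (i, l) else 0)"
      using P i j by (auto simp: scalar_prod_def intro!: sum.cong)
    show "(C * P) $$ (i, j) = (P * jordan_block n 0) $$ (i, j)"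
    \<comment> \<open>Right multiplication by the nilpotent block shifts the columns of
      \<open>P\<close> one place to the right. Column 0 becomes zero, which matches
      \<open>C ^\<^sub>m n\<close> applied to the last unit vector.\<close>
    proof (cases j)
      case 0
      then show ?thesis unfolding CP PJ using pow(1)[of i "n - 1" n] i by simp
    next
      case (Suc j')
      then show ?thesis unfolding CP PJ using i j by (simp add: P_def)
    qed
  qed (use C P in auto)
  then have "C = P * jordan_block n 0 * Q"
    using C P Q PQ J by (metis assoc_mult_mat right_mult_one_mat)
  then show ?thesis
    unfolding similar_mat_def using similar_mat_witI[OF PQ QP _ C J P Q] by blast
qed

text \<open>Since \<open>char_matrix M a\<close> is \<open>M\<close> minus the scalar matrix of
  \<open>a\<close>, the nilpotent case applies to it, and shifting back by \<open>- a\<close>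
  restores \<open>M\<close>. The criterion serves both powers and inverses of Jordan blocks.\<close>

lemma similar_mat_jordan_block:
  fixes M :: "'a :: field mat"
  assumes M: "M \<in> carrier_mat n n"
    and low: "\<And>i j. i < n \<Longrightarrow> j < i \<Longrightarrow> M $$ (i, j) = 0"
    and diag: "\<And>i. i < n \<Longrightarrow> M $$ (i, i) = a"
    and sup: "\<And>i. Suc i < n \<Longrightarrow> M $$ (i, Suc i) \<noteq> 0"
  shows "similar_mat M (jordan_block n a)"
proof -
  have "similar_mat (char_matrix M a) (jordan_block n 0)"
    using assms by (intro similar_mat_nilpotent_jordan_block)
      (auto simp: char_matrix_def dest: le_neq_implies_less)
  then obtain P Q where "similar_mat_wit (char_matrix M a) (jordan_block n 0) P Q"
    unfolding similar_mat_def by blast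
  from similar_mat_wit_char_matrix[OF this, of "- a"]
  have "similar_mat (char_matrix (char_matrix M a) (- a)) (jordan_block n a)"
    unfolding similar_mat_def by (auto simp: char_matrix_jordan_block)
  moreover have "char_matrix (char_matrix M a) (- a) = M"
    using M by (intro eq_matI) (auto simp: char_matrix_def)
  ultimately show ?thesis by simp
qed

text \<open>The superdiagonal entries of the power are \<open>r * a ^ (r - 1)\<close>, nonzero in
  characteristic 0.\<close>

lemma similar_mat_jordan_block_pow:
  fixes a :: "'a :: field_char_0"
  assumes "a \<noteq> 0" "r > 0"
  shows "similar_mat (jordan_block n a ^\<^sub>m r) (jordan_block n (a ^ r))"
  using assms by (intro similar_mat_jordan_block) (auto simp: jordan_block_pow)

text \<open>These are the coefficients of the finite geometric series for the inverse of
  \<open>a\<close> plus a nilpotent shift.\<close>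

definition jordan_block_inverse :: "nat \<Rightarrow> 'a :: field \<Rightarrow> 'a mat" where
  "jordan_block_inverse n a =
     mat n n (\<lambda>(i, j). if i \<le> j then (- 1) ^ (j - i) / a ^ Suc (j - i) else 0)"

lemma jordan_block_inverse_carrier [simp]:
  "jordan_block_inverse n a \<in> carrier_mat n n"
  "dim_row (jordan_block_inverse n a) = n" "dim_col (jordan_block_inverse n a) = n"
  by (auto simp: jordan_block_inverse_def)

lemma jordan_block_mult_inverse:
  assumes a: "a \<noteq> 0"
  shows "jordan_block n a * jordan_block_inverse n a = 1\<^sub>m n"
proof (rule eq_matI)
  let ?K = "jordan_block_inverse n a"
  fix i j assume "i < dim_row (1\<^sub>m n)" "j < dim_col (1\<^sub>m n)"
  then have i: "i < n" and j: "j < n" by auto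
  have "(jordan_block n a * ?K) $$ (i, j) = (\<Sum>l = 0..<n. jordan_block n a $$ (i, l) * ?K $$ (l, j))"
    using i j by (simp add: scalar_prod_def)
  also have "\<dots> = (\<Sum>l = 0..<n. (if l = i then a * ?K $$ (l, j) else 0) + (if l = Suc i then ?K $$ (l, j) else 0))"
    using i by (intro sum.cong) auto
  also have "\<dots> = a * ?K $$ (i, j) + (if Suc i < n then ?K $$ (Suc i, j) else 0)"
    using i by (simp add: sum.distrib)
  also have "\<dots> = 1\<^sub>m n $$ (i, j)"
  proof (cases "i < j")
    case True
    then have "j - i = Suc (j - Suc i)" by simp
    then show ?thesis
      using True i j a by (simp add: jordan_block_inverse_def field_simps)
  next
    case False
    then show ?thesis using i j a by (auto simp: jordan_block_inverse_def)
  qed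
  finally show "(jordan_block n a * ?K) $$ (i, j) = 1\<^sub>m n $$ (i, j)" .
qed auto

text \<open>The superdiagonal entries are \<open>- 1 / a ^ 2\<close>, hence nonzero.\<close>

lemma similar_mat_jordan_block_inverse:
  assumes "a \<noteq> 0"
  shows "similar_mat (jordan_block_inverse n a) (jordan_block n (inverse a))"
  using assms by (intro similar_mat_jordan_block)
    (auto simp: jordan_block_inverse_def field_simps)

section \<open>Spectrum, determinant and invertibility\<close>

lemma spectrum_jordan_nf:
  fixes A :: "'a :: field mat"
  assumes A: "A \<in> carrier_mat n n" and jnf: "jordan_nf A as"
  shows "spectrum A = snd ` set as"
proof -
  have "poly (char_poly A) x = 0 \<longleftrightarrow> x \<in> snd ` set as" for x
  proof -
    have "poly (char_poly A) x = 0 \<longleftrightarrow> (\<exists>(k, a) \<in> set as. k \<noteq> 0 \<and> x = a)"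
      unfolding jordan_nf_char_poly[OF jnf] poly_prod_list prod_list_zero_iff
      by (auto simp: image_iff Bex_def split: prod.splits)
    then show ?thesis
      using jnf by (force simp: jordan_nf_def)
  qed
  then show ?thesis by (auto simp: spectrum_root_char_poly[OF A])
qed

lemma zero_in_spectrum_iff_det:
  fixes A :: "'a :: field mat"
  assumes A: "A \<in> carrier_mat n n"
  shows "0 \<in> spectrum A \<longleftrightarrow> det A = 0"
proof -
  have "char_matrix A 0 = A" using A by (intro eq_matI) (auto simp: char_matrix_def)
  then show ?thesis
    using eigenvalue_det[OF A, of 0] by (simp add: spectrum_def)
qed

lemma invertible_mat_iff_zero_notin_spectrum:
  fixes A :: "'a :: field mat"
  assumes A: "A \<in> carrier_mat n n"
  shows "invertible_mat A \<longleftrightarrow> 0 \<notin> spectrum A"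
proof -
  note spec = zero_in_spectrum_iff_det[OF A]
  show ?thesis
  proof
    assume "invertible_mat A"
    then obtain B where AB: "A * B = 1\<^sub>m n" and BA: "B * A = 1\<^sub>m (dim_row B)"
      using A by (auto simp: invertible_mat_def inverts_mat_def)
    have "dim_col B = n" "dim_row B = n"
      using arg_cong[OF AB, of dim_col] arg_cong[OF BA, of dim_col] A by auto
    then have "det A * det B = 1"
      using det_mult[OF A carrier_matI, of B] AB by simp
    then show "0 \<notin> spectrum A" by (auto simp: spec)
  next
    assume "0 \<notin> spectrum A"
    then have "det A \<noteq> 0" by (simp add: spec)
    from det_non_zero_imp_unit[OF A this] obtain B where "B \<in> carrier_mat n n"
      "A * B = 1\<^sub>m n" "B * A = 1\<^sub>m n"
      unfolding Units_def by (auto simp: ring_mat_def)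
    then show "invertible_mat A"
      using A unfolding invertible_mat_def inverts_mat_def by (auto intro!: exI[of _ B])
  qed
qed

text \<open>Powers respect conjugation and act blockwise on block-diagonal matrices. A nonzero
  eigenvalue keeps each block in one piece, whereas powers of nilpotent blocks may split.\<close>

lemma jordan_nf_pow:
  fixes A :: "'a :: field_char_0 mat"
  assumes jnf: "jordan_nf A as" and nz: "0 \<notin> snd ` set as" and r: "r > 0"
  shows "jordan_nf (A ^\<^sub>m r) (map (\<lambda>(k, a). (k, a ^ r)) as)"
proof -
  let ?Ms = "map (\<lambda>(k, a). (jordan_block k a ^\<^sub>m r, jordan_block k (a ^ r))) as"
  have "similar_mat (A ^\<^sub>m r) (jordan_matrix as ^\<^sub>m r)"
    using jnf similar_mat_wit_pow unfolding jordan_nf_def similar_mat_def by blast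
  also have "jordan_matrix as ^\<^sub>m r = diag_block_mat (map fst ?Ms)"
    by (simp add: jordan_matrix_pow o_def split_def)
  also have "similar_mat \<dots> (diag_block_mat (map snd ?Ms))"
    using nz r by (intro similar_diag_mat_block_mat) (force intro!: similar_mat_jordan_block_pow)
  also (similar_mat_trans) have "diag_block_mat (map snd ?Ms)
      = jordan_matrix (map (\<lambda>(k, a). (k, a ^ r)) as)"
    by (simp add: jordan_matrix_def o_def split_def)
  finally show ?thesis using jnf by (force simp: jordan_nf_def)
qed

lemma jordan_matrix_mult_inverse:
  assumes "0 \<notin> snd ` set as"
  shows "jordan_matrix as * diag_block_mat (map (\<lambda>(k, a). jordan_block_inverse k a) as)
    = 1\<^sub>m (sum_list (map fst as))"
  using assms
proof (induction as)
  case Nil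
  then show ?case by (auto simp: jordan_matrix_def)
next
  case (Cons ka as)
  obtain k a where ka: "ka = (k, a)" by force
  let ?s = "sum_list (map fst as)"
  let ?D = "diag_block_mat (map (\<lambda>(k, a). jordan_block_inverse k a) as)"
  have dim: "dim_row ?D = ?s" "dim_col ?D = ?s"
    by (simp_all add: dim_diag_block_mat o_def split_def)
  have "jordan_matrix (ka # as) * diag_block_mat (map (\<lambda>(k, a). jordan_block_inverse k a) (ka # as))
    = four_block_mat (jordan_block k a) (0\<^sub>m k ?s) (0\<^sub>m ?s k) (jordan_matrix as)
      * four_block_mat (jordan_block_inverse k a) (0\<^sub>m k ?s) (0\<^sub>m ?s k) ?D"
    by (simp add: ka jordan_matrix_Cons Let_def dim)
  also have "\<dots> = four_block_mat (1\<^sub>m k) (0\<^sub>m k ?s) (0\<^sub>m ?s k) (1\<^sub>m ?s)"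
  proof (subst mult_four_block_mat[of _ k k _ ?s _ ?s])
    show "?D \<in> carrier_mat ?s ?s" using dim by auto
    then show "four_block_mat (jordan_block k a * jordan_block_inverse k a + 0\<^sub>m k ?s * 0\<^sub>m ?s k)
        (jordan_block k a * 0\<^sub>m k ?s + 0\<^sub>m k ?s * ?D)
        (0\<^sub>m ?s k * jordan_block_inverse k a + jordan_matrix as * 0\<^sub>m ?s k)
        (0\<^sub>m ?s k * 0\<^sub>m k ?s + jordan_matrix as * ?D)
      = four_block_mat (1\<^sub>m k) (0\<^sub>m k ?s) (0\<^sub>m ?s k) (1\<^sub>m ?s)"
      using Cons by (simp add: ka jordan_block_mult_inverse)
  qed auto
  finally show ?case by (simp add: ka)
qed

text \<open>With \<open>A = P * J * Q\<close>, the matrix \<open>P * K * Q\<close> is a right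
  inverse of \<open>A\<close> while \<open>B\<close> is a left inverse, so they coincide.\<close>

lemma similar_mat_inverse:
  fixes A :: "'a :: comm_ring_1 mat"
  assumes sim: "similar_mat A J" and A: "A \<in> carrier_mat n n"
    and B: "B \<in> carrier_mat n n" and BA: "B * A = 1\<^sub>m n"
    and K: "K \<in> carrier_mat n n" and JK: "J * K = 1\<^sub>m n"
  shows "similar_mat B K"
proof -
  from sim obtain P Q where wit: "similar_mat_wit A J P Q" unfolding similar_mat_def by blast
  note w = similar_mat_witD2[OF A wit]
  note [simp] = assoc_mult_mat[of _ n n _ n _ n]
  have "A * (P * K * Q) = P * (J * (Q * P) * K) * Q"
    by (subst w(3)) (use w(4-7) B K in simp)
  also have "\<dots> = 1\<^sub>m n" using w B K JK by simp
  finally have "B = B * (A * (P * K * Q))" using B by simp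
  also have "\<dots> = (B * A) * (P * K * Q)" using w(4-7) B K by simp
  also have "\<dots> = P * K * Q" using BA w(4-7) K by simp
  finally show ?thesis
    unfolding similar_mat_def using similar_mat_witI[OF w(1,2) _ B K w(6,7)] by blast
qed

lemma jordan_nf_inverse:
  fixes A :: "'a :: field mat"
  assumes A: "A \<in> carrier_mat n n" and B: "B \<in> carrier_mat n n" and BA: "B * A = 1\<^sub>m n"
    and jnf: "jordan_nf A as" and nz: "0 \<notin> snd ` set as"
  shows "jordan_nf B (map (\<lambda>(k, a). (k, inverse a)) as)"
proof -
  let ?Ms = "map (\<lambda>(k, a). (jordan_block_inverse k a, jordan_block k (inverse a))) as"
  let ?K = "diag_block_mat (map (\<lambda>(k, a). jordan_block_inverse k a) as)"
  have sim: "similar_mat A (jordan_matrix as)" using jnf by (simp add: jordan_nf_def)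
  have n: "n = sum_list (map fst as)"
    using similar_matD[OF sim] A by (metis carrier_matD(1) insert_subset jordan_matrix_dim(1))
  have "dim_row ?K = n" "dim_col ?K = n"
    by (simp_all add: n dim_diag_block_mat o_def split_def)
  then have "?K \<in> carrier_mat n n" by auto
  then have "similar_mat B ?K"
    using jordan_matrix_mult_inverse[OF nz] by (intro similar_mat_inverse[OF sim A B BA]) (auto simp: n)
  also have "?K = diag_block_mat (map fst ?Ms)"
    by (simp add: o_def split_def)
  also have "similar_mat \<dots> (diag_block_mat (map snd ?Ms))"
    using nz by (intro similar_diag_mat_block_mat) (force intro!: similar_mat_jordan_block_inverse)
  also (similar_mat_trans) have "diag_block_mat (map snd ?Ms)
      = jordan_matrix (map (\<lambda>(k, a). (k, inverse a)) as)"
    by (simp add: jordan_matrix_def o_def split_def)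
  finally show ?thesis using jnf by (force simp: jordan_nf_def)
qed

text \<open>A negative power is a positive power of the inverse, so the eigenvalues undergo
  \<open>inverse\<close> followed by a natural power.\<close>

lemma jordan_nf_mat_powi:
  assumes A: "A \<in> carrier_mat n n" and inv: "invertible_mat A" and jnf: "jordan_nf A as"
    and p: "p \<noteq> 0"
  shows "jordan_nf (mat_powi A p) (map (\<lambda>(k, a). (k, a powi p)) as)"
proof -
  have nz: "0 \<notin> snd ` set as"
    using inv invertible_mat_iff_zero_notin_spectrum[OF A] spectrum_jordan_nf[OF A jnf] by simp
  show ?thesis
  proof (cases "p > 0")
    case True
    then show ?thesis
      using jordan_nf_pow[OF jnf nz, of "nat p"] by (simp add: mat_powi_def power_int_def)
  next
    case False
    have "A \<in> Units (ring_mat TYPE(complex) n ())"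
      using inv A invertible_mat_iff_zero_notin_spectrum[OF A] zero_in_spectrum_iff_det[OF A]
      by (intro det_non_zero_imp_unit[OF A]) simp
    then obtain B where "mat_inverse A = Some B"
      using mat_inverse(1)[OF A, of "()"] by (cases "mat_inverse A") auto
    with mat_inverse(2)[OF A this] have B: "the (mat_inverse A) = B" "B \<in> carrier_mat n n" "B * A = 1\<^sub>m n"
      by auto
    have "jordan_nf (B ^\<^sub>m nat (- p)) (map (\<lambda>(k, a). (k, a ^ nat (- p))) (map (\<lambda>(k, a). (k, inverse a)) as))"
      using nz p False by (intro jordan_nf_pow jordan_nf_inverse[OF A B(2,3) jnf]) auto
    then show ?thesis
      using False p by (simp add: mat_powi_def B(1) power_int_def o_def split_def)
  qed
qed

section \<open>Eigenvalue multisets\<close>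

lemma eigenvalue_mset_jordan_nf:
  assumes "jordan_nf A as"
  shows "eigenvalue_mset A = (\<Sum>(k, a)\<leftarrow>as. replicate_mset k a)"
  unfolding eigenvalue_mset_def jordan_nf_char_poly[OF assms]
proof (induction as)
  case (Cons ka as)
  obtain k a where ka: "ka = (k, a)" by force
  have "(\<Prod>(k, a)\<leftarrow>as. [:- a, 1:] ^ k) \<noteq> 0" by (auto simp: prod_list_zero_iff)
  with Cons show ?case by (simp add: ka proots_mult proots_power)
qed simp

lemma set_mset_eigenvalue_mset:
  assumes "A \<in> carrier_mat n n"
  shows "set_mset (eigenvalue_mset A) = spectrum A"
proof -
  have "char_poly A \<noteq> 0" using degree_monic_char_poly[OF assms] by auto
  then show ?thesis by (simp add: eigenvalue_mset_def spectrum_root_char_poly[OF assms])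
qed

subsection \<open>Injectivity of power maps on the spectrum\<close>

text \<open>A chain \<open>y 0 = x\<close>, \<open>y 1\<close>, ... in \<open>S\<close> with
  \<open>y (Suc k) powi p = y k powi q\<close> must repeat, as \<open>S\<close> is finite. A return
  to \<open>y i\<close> after \<open>k\<close> steps equates its powers with exponents
  \<open>p ^ k\<close> and \<open>q ^ k\<close>, making \<open>y i\<close> a root of unity. The
  relation between \<open>x\<close> and \<open>y i\<close> transfers this to
  \<open>x\<close>.\<close>

lemma powi_image_subset_imp_root_of_unity:
  fixes S :: "'a :: field set"
  assumes fin: "finite S" and nz: "0 \<notin> S"
    and p: "p \<noteq> 0" and q: "q \<noteq> 0" and pq: "\<bar>p\<bar> \<noteq> \<bar>q\<bar>"
    and sub: "(\<lambda>x. x powi q) ` S \<subseteq> (\<lambda>x. x powi p) ` S"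
    and x: "x \<in> S"
  shows "\<exists>N>0. x ^ N = 1"
proof -
  have "\<exists>y\<in>S. y powi p = x powi q" if "x \<in> S" for x
  proof -
    have "x powi q \<in> (\<lambda>x. x powi p) ` S" using sub that by blast
    then show ?thesis by auto
  qed
  then obtain f where f: "\<And>x. x \<in> S \<Longrightarrow> f x \<in> S" "\<And>x. x \<in> S \<Longrightarrow> f x powi p = x powi q"
    by metis
  define y where "y k = (f ^^ k) x" for k
  have y: "y k \<in> S" for k by (induction k) (auto simp: y_def x f)
  have step: "y (Suc k) powi p = y k powi q" for k using f(2)[OF y[of k]] by (simp add: y_def)
  have iter: "y (i + k) powi (p ^ k) = y i powi (q ^ k)" for i k
  proof (induction k)
    case (Suc k)
    have "y (i + Suc k) powi (p ^ Suc k) = (y (Suc (i + k)) powi p) powi (p ^ k)"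
      by (simp add: power_int_mult)
    also have "\<dots> = (y (i + k) powi (p ^ k)) powi q"
      by (simp add: step mult.commute flip: power_int_mult)
    also have "\<dots> = y i powi (q ^ Suc k)"
      by (simp add: Suc mult.commute flip: power_int_mult)
    finally show ?case .
  qed simp
  have "\<not> inj y"
    using y fin by (meson finite_subset image_subsetI range_inj_infinite)
  then obtain i j where ij: "i < j" "y i = y j"
    by (metis injI linorder_neqE_nat)
  define k m where "k = j - i" and "m = p ^ k - q ^ k"
  have "k > 0" using ij by (simp add: k_def)
  then have "\<bar>p\<bar> ^ k \<noteq> \<bar>q\<bar> ^ k" using pq by (simp add: power_eq_iff_eq_base)
  then have m: "m \<noteq> 0" by (auto simp: m_def simp flip: power_abs)
  have nz_i: "y i \<noteq> 0" using y[of i] nz by auto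
  have "y i powi (p ^ k) = y i powi (q ^ k)" using iter[of i k] ij by (simp add: k_def)
  then have "y i powi m = 1" using nz_i by (simp add: m_def power_int_diff)
  moreover have "x powi (q ^ i) = y i powi (p ^ i)" using iter[of 0 i] by (simp add: y_def)
  ultimately have "x powi (q ^ i * m) = 1"
    by (metis mult.commute power_int_1_left power_int_mult)
  moreover have "q ^ i * m \<noteq> 0" using q m by simp
  ultimately have "x ^ nat \<bar>q ^ i * m\<bar> = 1"
    by (auto simp: power_int_def abs_if power_inverse split: if_splits)
  with \<open>q ^ i * m \<noteq> 0\<close> show ?thesis by (intro exI[of _ "nat \<bar>q ^ i * m\<bar>"]) simp
qed

text \<open>Injectivity makes the description in \<open>eigen_perm\<close> proper. The hypotheses
  are symmetric, so the result also covers the exponent \<open>q\<close>.\<close>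

lemma inj_on_coprime_powi:
  fixes S :: "'a :: field set"
  assumes fin: "finite S" and nz: "0 \<notin> S"
    and cop: "coprime p q" and pq: "\<bar>p\<bar> + \<bar>q\<bar> > 2"
    and img: "(\<lambda>x. x powi p) ` S = (\<lambda>x. x powi q) ` S"
  shows "inj_on (\<lambda>x. x powi p) S"
proof -
  have pq0: "p \<noteq> 0" "q \<noteq> 0" "\<bar>p\<bar> \<noteq> \<bar>q\<bar>"
  proof -
    show "p \<noteq> 0" "q \<noteq> 0" using cop pq by auto
    \<comment> \<open>Equal absolute values would make \<open>p\<close> a common divisor, hence a
      unit, and the sum would be 2.\<close>
    show "\<bar>p\<bar> \<noteq> \<bar>q\<bar>"
    proof
      assume "\<bar>p\<bar> = \<bar>q\<bar>"
      then have "p dvd q" using dvd_if_abs_eq by blast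
      then have "is_unit p" using cop by (metis coprime_common_divisor dvd_refl)
      then show False using pq \<open>\<bar>p\<bar> = \<bar>q\<bar>\<close> by simp
    qed
  qed
  have "\<forall>x\<in>S. \<exists>N>0. x ^ N = 1"
    using powi_image_subset_imp_root_of_unity[OF fin nz pq0] img by blast
  then obtain e where e: "\<And>x. x \<in> S \<Longrightarrow> e x > 0 \<and> x ^ e x = 1" by metis
  define Q where "Q N \<longleftrightarrow> N > 0 \<and> (\<forall>x\<in>S. x ^ N = 1)" for N :: nat
  \<comment> \<open>The product of the individual exponents over the finite set is a common one, so
    a least one exists.\<close>
  have "Q (prod e S)"
    unfolding Q_def
  proof (intro conjI ballI)
    show "0 < prod e S" using e by (intro prod_pos) auto
    fix x assume x: "x \<in> S"
    then obtain c where "prod e S = e x * c" using fin dvd_prodI by (metis dvdE)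
    then show "x ^ prod e S = 1" using e[OF x] by (simp add: power_mult)
  qed
  define N where "N = (LEAST N. Q N)"
  have N: "Q N" and least: "\<And>M. Q M \<Longrightarrow> N \<le> M"
    unfolding N_def using \<open>Q (prod e S)\<close> by (auto intro: LeastI Least_le)
  have N_pos: "int N > 0" and xN: "\<And>x. x \<in> S \<Longrightarrow> x powi int N = 1"
    using N by (auto simp: Q_def)
  \<comment> \<open>With \<open>N\<close> the exponent of the group generated by \<open>S\<close> and \<open>g\<close> the gcd of \<open>N\<close> and \<open>p\<close>, every \<open>p\<close>-th
    power of an element of \<open>S\<close> is killed by \<open>M = N / g\<close>, hence so is every \<open>q\<close>-th power, and as \<open>q\<close> is
    coprime to \<open>g\<close> so is \<open>S\<close> itself; minimality of \<open>N\<close> gives \<open>g = 1\<close>.\<close>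
  define g where "g = gcd (int N) p"
  obtain M p' where M: "int N = g * M" and p': "p = g * p'"
    unfolding g_def by (metis dvdE gcd_dvd1 gcd_dvd2)
  have g: "g > 0" using N_pos by (simp add: g_def)
  have Mpos: "M > 0" using N_pos M g by (simp add: zero_less_mult_iff)
  have "coprime q g"
    using cop p' by (metis coprime_commute coprime_mult_left_iff)
  then obtain u v where uv: "u * q + v * g = 1"
    using bezout_int[of q g] by auto
  have "x powi M = 1" if x: "x \<in> S" for x
  proof -
    have x0: "x \<noteq> 0" using x nz by auto
    obtain y where y: "y \<in> S" "x powi q = y powi p"
      using img x by (metis (no_types, lifting) imageE image_eqI)
    have "x powi (q * M) = y powi (int N * p')"
      using y(2) M p' by (metis mult.assoc mult.commute power_int_mult)
    then have qM: "x powi (q * M) = 1" using xN[OF y(1)] by (simp add: power_int_mult)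
    \<comment> \<open>This is the Bezout identity for \<open>q\<close> and \<open>g\<close>
      multiplied by \<open>M\<close>, with \<open>g * M = int N\<close>.\<close>
    have "M = (q * M) * u + int N * v"
      using uv M by (metis (no_types, opaque_lifting) distrib_right mult.assoc mult.commute mult_1)
    then have "x powi M = (x powi (q * M)) powi u * (x powi int N) powi v"
      using x0 by (metis power_int_add power_int_mult)
    then show ?thesis using qM xN[OF x] by simp
  qed
  then have "Q (nat M)" using Mpos by (auto simp: Q_def power_int_def)
  from least[OF this] have "int N \<le> M" using Mpos by simp
  then have "g \<le> 1" using M Mpos by (simp add: mult_le_cancel_right1)
  then have "g = 1" using g by simp
  \<comment> \<open>Here \<open>b\<close> inverts \<open>p\<close> modulo \<open>N\<close>, so the
    \<open>b\<close>-th power undoes the \<open>p\<close>-th power on \<open>S\<close>.\<close>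
  then obtain a b where ab: "a * int N + b * p = 1"
    using bezout_int[of "int N" p] by (auto simp: g_def)
  show ?thesis
  proof (rule inj_onI)
    fix x y assume xy: "x \<in> S" "y \<in> S" "x powi p = y powi p"
    have id: "z = (z powi p) powi b" if "z \<in> S" for z
    proof -
      have "z \<noteq> 0" using that nz by auto
      then have "z powi (int N * a + p * b) = (z powi int N) powi a * (z powi p) powi b"
        by (simp add: power_int_add power_int_mult)
      moreover have "int N * a + p * b = 1" using ab by (simp add: algebra_simps)
      ultimately show ?thesis using xN[OF that] by simp
    qed
    show "x = y" using id[OF xy(1)] id[OF xy(2)] xy(3) by simp
  qed
qed

text \<open>By injectivity, the point \<open>g x = f (h x)\<close> has multiplicity
  \<open>count M x\<close> in one image and \<open>count M (h x)\<close> in the other. The criterion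
  is applied to eigenvalues and again to Jordan blocks.\<close>

lemma image_mset_eq_iff_count:
  assumes f: "inj_on f T" and g: "inj_on g T" and img: "f ` T = g ` T"
    and h: "\<And>x. x \<in> T \<Longrightarrow> h x \<in> T" "\<And>x. x \<in> T \<Longrightarrow> f (h x) = g x"
    and M: "set_mset M \<subseteq> T"
  shows "image_mset f M = image_mset g M \<longleftrightarrow> (\<forall>x\<in>T. count M (h x) = count M x)"
proof -
  have cnt: "count (image_mset k M) (k x) = count M x" if "inj_on k T" "x \<in> T" for k :: "'a \<Rightarrow> 'b" and x
  proof -
    have "k -` {k x} \<inter> set_mset M = {x} \<inter> set_mset M"
      using that M by (auto dest: inj_onD)
    then show ?thesis
      by (cases "x \<in># M") (auto simp: count_image_mset not_in_iff)
  qed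
  show ?thesis
  proof
    assume eq: "image_mset f M = image_mset g M"
    show "\<forall>x\<in>T. count M (h x) = count M x"
      using cnt[OF f h(1)] cnt[OF g] h(2) eq by metis
  next
    assume c: "\<forall>x\<in>T. count M (h x) = count M x"
    show "image_mset f M = image_mset g M"
    proof (rule multiset_eqI)
      fix y
      show "count (image_mset f M) y = count (image_mset g M) y"
      proof (cases "y \<in> g ` T")
        case True
        then obtain x where "x \<in> T" "y = g x" by auto
        then show ?thesis using cnt[OF f h(1)] cnt[OF g] h(2) c by metis
      next
        case False
        then have "y \<notin># image_mset f M" "y \<notin># image_mset g M" using M img by auto
        then show ?thesis by (metis count_inI)
      qed
    qed
  qed
qed

subsection \<open>Orbits of eigenvalues\<close>

text \<open>Existence comes from the equality of images, uniqueness from injectivity of the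
  \<open>p\<close>-th power.\<close>

lemma eigen_perm:
  assumes inj: "inj_on (\<lambda>x. x powi p) (spectrum A)"
    and img: "(\<lambda>x. x powi p) ` spectrum A = (\<lambda>x. x powi q) ` spectrum A"
    and x: "x \<in> spectrum A"
  shows "eigen_perm p q A x \<in> spectrum A" and "eigen_perm p q A x powi p = x powi q"
proof -
  have "\<exists>!y. y \<in> spectrum A \<and> x powi q = y powi p"
  proof -
    have "x powi q \<in> (\<lambda>x. x powi p) ` spectrum A" unfolding img using x by blast
    then obtain y where "y \<in> spectrum A" "x powi q = y powi p" by auto
    then show ?thesis using inj by (auto dest: inj_onD)
  qed
  from theI'[OF this] show "eigen_perm p q A x \<in> spectrum A" and "eigen_perm p q A x powi p = x powi q"
    unfolding eigen_perm_def by auto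
qed

text \<open>Both directions of the orbit relation use forward iterates, so invariance under one
  forward step suffices by induction.\<close>

lemma eigen_orbit_invariant:
  assumes perm: "\<And>x. x \<in> spectrum A \<Longrightarrow> eigen_perm p q A x \<in> spectrum A"
    and c: "\<And>x. x \<in> spectrum A \<Longrightarrow> c (eigen_perm p q A x) = c x"
    and x: "x \<in> spectrum A" and y: "y \<in> eigen_orbit p q A x"
  shows "c y = c x"
proof -
  have "(eigen_perm p q A ^^ k) z \<in> spectrum A \<and> c ((eigen_perm p q A ^^ k) z) = c z"
    if "z \<in> spectrum A" for k z
    by (induction k) (use that perm c in auto)
  then show ?thesis using x y by (auto simp: eigen_orbit_def)
qed

lemma eigen_orbit_self: "x \<in> spectrum A \<Longrightarrow> x \<in> eigen_orbit p q A x"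
  by (auto simp: eigen_orbit_def intro!: exI[of _ "0 :: nat"])

lemma eigen_perm_in_orbit:
  "eigen_perm p q A x \<in> spectrum A \<Longrightarrow> eigen_perm p q A x \<in> eigen_orbit p q A x"
  by (auto simp: eigen_orbit_def intro!: exI[of _ "1 :: nat"])

text \<open>The member \<open>z\<close> makes the value unique; on an empty set every
  \<open>r\<close> would qualify.\<close>

lemma orbit_multiplicity_eqI:
  "z \<in> X \<Longrightarrow> (\<And>x. x \<in> X \<Longrightarrow> count (eigenvalue_mset A) x = r) \<Longrightarrow> orbit_multiplicity A X = r"
  unfolding orbit_multiplicity_def by (rule the_equality) auto

subsection \<open>Grouping Jordan blocks by eigenvalue\<close>

lemma smult_one_plus_nilpotent_jordan:
  "a \<cdot>\<^sub>m 1\<^sub>m (sum_list bs) + nilpotent_jordan bs = jordan_matrix (map (\<lambda>b. (b, a)) bs)"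
  unfolding nilpotent_jordan_def
proof (induction bs)
  case Nil
  then show ?case by (auto simp: jordan_matrix_def)
next
  case (Cons b bs)
  have "jordan_matrix (map (\<lambda>b. (b, a)) (b # bs)) = four_block_mat (jordan_block b a)
      (0\<^sub>m b (sum_list bs)) (0\<^sub>m (sum_list bs) b)
      (a \<cdot>\<^sub>m 1\<^sub>m (sum_list bs) + jordan_matrix (map (\<lambda>b. (b, 0)) bs))"
    unfolding Cons by (simp add: jordan_matrix_Cons o_def)
  also have "\<dots> = a \<cdot>\<^sub>m 1\<^sub>m (sum_list (b # bs)) + jordan_matrix (map (\<lambda>b. (b, 0)) (b # bs))"
    by (rule eq_matI) (auto simp: jordan_matrix_Cons o_def)
  finally show ?case by simp
qed

text \<open>Uniqueness of the Jordan form recovers the block sizes from the matrix. Blocks of size 0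
  would leave no trace in it.\<close>

lemma nilpotent_jordan_inject:
  assumes "0 \<notin> set bs" "0 \<notin> set bs'" and eq: "nilpotent_jordan bs = nilpotent_jordan bs'"
  shows "mset bs = mset bs'"
proof -
  have "jordan_nf (nilpotent_jordan bs) (map (\<lambda>b. (b, 0)) bs)"
    using assms(1) similar_mat_refl[OF jordan_matrix_carrier]
    by (auto simp: jordan_nf_def nilpotent_jordan_def)
  moreover have "jordan_nf (nilpotent_jordan bs) (map (\<lambda>b. (b, 0)) bs')"
    unfolding eq using assms(2) similar_mat_refl[OF jordan_matrix_carrier]
    by (auto simp: jordan_nf_def nilpotent_jordan_def)
  ultimately have "mset (map (\<lambda>b. (b, 0 :: complex)) bs) = mset (map (\<lambda>b. (b, 0)) bs')"
    by (rule jordan_nf_mset_unique)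
  then have "image_mset fst (mset (map (\<lambda>b. (b, 0 :: complex)) bs))
      = image_mset fst (mset (map (\<lambda>b. (b, 0 :: complex)) bs'))" by simp
  then show ?thesis by (simp add: image_mset.compositionality o_def)
qed

text \<open>The list \<open>f k\<close> holds the block sizes for \<open>lams ! k\<close>, and the
  order is that of the diagonal in \<open>grouped_jordan_form\<close>.\<close>

definition grouped_blocks :: "'a list \<Rightarrow> (nat \<Rightarrow> nat list) \<Rightarrow> (nat \<times> 'a) list" where
  "grouped_blocks lams f = concat (map (\<lambda>k. map (\<lambda>b. (b, lams ! k)) (f k)) [0..<length lams])"

lemma set_grouped_blocks:
  "set (grouped_blocks lams f) = {(b, lams ! k) | b k. k < length lams \<and> b \<in> set (f k)}"
  by (auto simp: grouped_blocks_def)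

lemma count_grouped_blocks:
  assumes "distinct lams" "k < length lams"
  shows "count (mset (grouped_blocks lams f)) (n, lams ! k) = count (mset (f k)) n"
proof -
  let ?x = "(n, lams ! k)"
  let ?g = "\<lambda>j. map (\<lambda>b. (b, lams ! j)) (f j)"
  have "count (mset (concat (map ?g [0..<m]))) ?x = (\<Sum>j<m. count (mset (?g j)) ?x)" for m
    by (induction m) auto
  then have "count (mset (grouped_blocks lams f)) ?x = (\<Sum>j<length lams. count (mset (?g j)) ?x)"
    by (simp add: grouped_blocks_def)
  also have "\<dots> = (\<Sum>j<length lams. if j = k then count (mset (?g k)) ?x else 0)"
  proof (rule sum.cong)
    fix j assume "j \<in> {..<length lams}"
    then have "j \<noteq> k \<Longrightarrow> ?x \<notin># mset (?g j)"
      using assms by (auto simp: nth_eq_iff_index_eq)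
    then show "count (mset (?g j)) ?x = (if j = k then count (mset (?g k)) ?x else 0)"
      by (metis count_inI)
  qed simp
  also have "\<dots> = count (mset (?g k)) ?x" using assms(2) by simp
  also have "\<dots> = count (mset (f k)) n"
  proof -
    have "count (mset (map (\<lambda>b. (b, x)) bs)) (n, x) = count (mset bs) n" for x :: 'a and bs
      by (induction bs) auto
    then show ?thesis .
  qed
  finally show ?thesis .
qed

text \<open>Choosing block sizes for each \<open>Ns ! k\<close> turns the grouped form into an
  ordinary Jordan normal form, to which uniqueness applies.\<close>

lemma grouped_jordan_formE:
  assumes "grouped_jordan_form A lams mults Ns P Q"
  obtains f where "\<And>k. k < length lams \<Longrightarrow> 0 \<notin> set (f k)"
    "\<And>k. k < length lams \<Longrightarrow> Ns ! k = nilpotent_jordan (f k)"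
    "jordan_nf A (grouped_blocks lams f)"
proof -
  have "\<forall>k. \<exists>bs. k < length lams \<longrightarrow> 0 \<notin> set bs \<and> Ns ! k = nilpotent_jordan bs"
    using assms by (auto simp: grouped_jordan_form_def is_nilpotent_jordan_def)
  then obtain f where f: "\<And>k. k < length lams \<Longrightarrow> 0 \<notin> set (f k)"
    "\<And>k. k < length lams \<Longrightarrow> Ns ! k = nilpotent_jordan (f k)"
    by metis
  have "lams ! k \<cdot>\<^sub>m 1\<^sub>m (mults ! k) + Ns ! k = jordan_matrix (map (\<lambda>b. (b, lams ! k)) (f k))"
    if k: "k < length lams" for k
  proof -
    have "Ns ! k \<in> carrier_mat (mults ! k) (mults ! k)"
      using assms k by (auto simp: grouped_jordan_form_def)
    \<comment> \<open>Comparing dimensions lets the scalar and nilpotent summands merge into Jordan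
      blocks.\<close>
    then have "mults ! k = sum_list (f k)"
      by (auto simp: f(2)[OF k] nilpotent_jordan_def o_def)
    then show ?thesis by (simp add: f(2)[OF k] smult_one_plus_nilpotent_jordan)
  qed
  then have "map (\<lambda>k. lams ! k \<cdot>\<^sub>m 1\<^sub>m (mults ! k) + Ns ! k) [0..<length lams]
      = map jordan_matrix (map (\<lambda>k. map (\<lambda>b. (b, lams ! k)) (f k)) [0..<length lams])"
    by simp
  then have "similar_mat A (jordan_matrix (grouped_blocks lams f))"
    using assms unfolding grouped_jordan_form_def similar_mat_def grouped_blocks_def
      jordan_matrix_concat_diag_block_mat by metis
  moreover have "0 \<notin> fst ` set (grouped_blocks lams f)"
    using f(1) by (auto simp: set_grouped_blocks)
  ultimately show ?thesis using f that by (auto simp: jordan_nf_def)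
qed

text \<open>Sorting the blocks by eigenvalue only permutes them. The singular case needs such a form
  for its invertible part.\<close>

lemma ex_grouped_jordan_form:
  assumes A: "A \<in> carrier_mat n n" and jnf: "jordan_nf A as"
  shows "\<exists>lams mults Ns P Q. grouped_jordan_form A lams mults Ns P Q"
proof -
  obtain lams where lams: "set lams = spectrum A" "distinct lams"
    using finite_distinct_list card_finite_spectrum(1)[OF A] by blast
  define f where "f k = map fst (filter (\<lambda>na. snd na = lams ! k) as)" for k
  define mults where "mults = map (count (eigenvalue_mset A)) lams"
  define Ns where "Ns = map (\<lambda>k. nilpotent_jordan (f k)) [0..<length lams]"
  have f0: "0 \<notin> set (f k)" for k using jnf by (auto simp: f_def jordan_nf_def)
  have "char_poly A \<noteq> 0" using degree_monic_char_poly[OF A] by auto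
  then have mults: "mults ! k = sum_list (f k)" if "k < length lams" for k
    using that by (simp add: mults_def f_def eigenvalue_mset_def jordan_nf_order[OF jnf])
  have "mset (grouped_blocks lams f) = mset as"
  proof (rule multiset_eqI)
    fix nx :: "nat \<times> complex"
    obtain n x where nx: "nx = (n, x)" by force
    show "count (mset (grouped_blocks lams f)) nx = count (mset as) nx"
    proof (cases "x \<in> spectrum A")
      case True
      then obtain k where k: "k < length lams" "x = lams ! k"
        using lams by (metis in_set_conv_nth)
      have "count (mset (map fst (filter (\<lambda>na. snd na = x) as))) n = count (mset as) (n, x)"
        by (induction as) auto
      then show ?thesis
        using count_grouped_blocks[OF lams(2) k(1), of f n] by (simp add: nx k(2) f_def)
    next
      case False
      then have "nx \<notin># mset (grouped_blocks lams f)" "nx \<notin># mset as"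
        using spectrum_jordan_nf[OF A jnf] lams by (auto simp: nx set_grouped_blocks image_iff)
      then show ?thesis by (metis count_inI)
    qed
  qed
  from similar_mat_jordan_matrix_mset[OF this]
  have "similar_mat A (jordan_matrix (grouped_blocks lams f))"
    using jnf similar_mat_trans similar_mat_sym unfolding jordan_nf_def by blast
  moreover have "jordan_matrix (grouped_blocks lams f) = diag_block_mat
      (map (\<lambda>k. lams ! k \<cdot>\<^sub>m 1\<^sub>m (mults ! k) + Ns ! k) [0..<length lams])"
    unfolding grouped_blocks_def jordan_matrix_concat_diag_block_mat
    by (intro arg_cong[of _ _ diag_block_mat])
      (simp add: mults Ns_def smult_one_plus_nilpotent_jordan)
  ultimately obtain P Q where "similar_mat_wit A (diag_block_mat
      (map (\<lambda>k. lams ! k \<cdot>\<^sub>m 1\<^sub>m (mults ! k) + Ns ! k) [0..<length lams])) P Q"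
    unfolding similar_mat_def by metis
  moreover have "Ns ! k \<in> carrier_mat (mults ! k) (mults ! k)" "is_nilpotent_jordan (Ns ! k)"
    if "k < length lams" for k
    using that f0 by (auto simp: mults Ns_def nilpotent_jordan_def is_nilpotent_jordan_def o_def)
  ultimately have "grouped_jordan_form A lams mults Ns P Q"
    using lams by (simp add: grouped_jordan_form_def mults_def[symmetric]) (simp add: Ns_def)
  then show ?thesis by blast
qed

section \<open>The invertible case\<close>

lemma similar_mat_powi_iff_orbit_condition:
  assumes cop: "coprime p q" and pq: "\<bar>p\<bar> + \<bar>q\<bar> > 2"
    and A: "A \<in> carrier_mat n n" and inv: "invertible_mat A"
    and eq: "mset_powi (eigenvalue_mset A) p = mset_powi (eigenvalue_mset A) q"
    and grouped: "grouped_jordan_form A lams mults Ns P Q"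
  shows "similar_mat (mat_powi A p) (mat_powi A q) \<longleftrightarrow> orbit_condition p q A lams mults Ns"
proof -
  let ?S = "spectrum A" and ?U = "eigenvalue_mset A" and ?\<pi> = "eigen_perm p q A"
  have pq0: "p \<noteq> 0" "q \<noteq> 0" using cop pq by auto
  have nz: "0 \<notin> ?S" using inv invertible_mat_iff_zero_notin_spectrum[OF A] by simp
  have fin: "finite ?S" by (rule card_finite_spectrum(1)[OF A])
  have U: "set_mset ?U = ?S" by (rule set_mset_eigenvalue_mset[OF A])
  have img: "(\<lambda>x. x powi p) ` ?S = (\<lambda>x. x powi q) ` ?S"
    using arg_cong[OF eq, of set_mset] by (simp add: mset_powi_def U)
  have inj_p: "inj_on (\<lambda>x. x powi p) ?S"
    using inj_on_coprime_powi[OF fin nz cop pq img] .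
  have inj_q: "inj_on (\<lambda>x. x powi q) ?S"
    using cop pq by (intro inj_on_coprime_powi[OF fin nz _ _ img[symmetric]])
      (simp_all add: coprime_commute)
  note perm = eigen_perm[OF inj_p img]
  \<comment> \<open>The assumed equality of eigenvalue multisets makes algebraic multiplicities
    invariant under the permutation.\<close>
  have mult: "count ?U (?\<pi> x) = count ?U x" if "x \<in> ?S" for x
    using image_mset_eq_iff_count[OF inj_p inj_q img, of ?\<pi> ?U] perm eq U that
    by (simp add: mset_powi_def)
  have lams: "distinct lams" "set lams = ?S" and mults: "mults = map (count ?U) lams"
    using grouped by (auto simp: grouped_jordan_form_def)
  obtain f where f0: "\<And>k. k < length lams \<Longrightarrow> 0 \<notin> set (f k)"
    and Ns: "\<And>k. k < length lams \<Longrightarrow> Ns ! k = nilpotent_jordan (f k)"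
    and jnf: "jordan_nf A (grouped_blocks lams f)"
    using grouped_jordan_formE[OF grouped] by metis
  define M where "M = mset (grouped_blocks lams f)"
  have count_M: "count M (b, lams ! k) = count (mset (f k)) b" if "k < length lams" for b k
    unfolding M_def using count_grouped_blocks[OF lams(1) that] .
  have M_sub: "set_mset M \<subseteq> UNIV \<times> ?S"
    unfolding M_def spectrum_jordan_nf[OF A jnf] by force
  have img': "(\<lambda>(b :: nat, x). (b, x powi p)) ` (UNIV \<times> ?S) = (\<lambda>(b, x). (b, x powi q)) ` (UNIV \<times> ?S)"
  proof -
    have "(\<lambda>(b :: nat, x). (b, x powi r)) ` (UNIV \<times> ?S) = UNIV \<times> (\<lambda>x. x powi r) ` ?S" for r
      by force
    then show ?thesis using img by simp
  qed
  have "similar_mat (mat_powi A p) (mat_powi A q) \<longleftrightarrow>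
      image_mset (\<lambda>(b, x). (b, x powi p)) M = image_mset (\<lambda>(b, x). (b, x powi q)) M"
    using similar_mat_iff_jordan_nf_mset[OF jordan_nf_mat_powi[OF A inv jnf pq0(1)]
        jordan_nf_mat_powi[OF A inv jnf pq0(2)]] by (simp add: M_def)
  \<comment> \<open>The counting criterion is now used on pairs of size and eigenvalue, where the
    power maps and the permutation act on the second component only.\<close>
  also have "\<dots> \<longleftrightarrow> (\<forall>x \<in> UNIV \<times> ?S. count M ((\<lambda>(b, x). (b, ?\<pi> x)) x) = count M x)"
    using inj_p inj_q perm M_sub
    by (intro image_mset_eq_iff_count[OF _ _ img']) (auto simp: inj_on_def)
  also have "\<dots> \<longleftrightarrow> (\<forall>x \<in> ?S. \<forall>b. count M (b, ?\<pi> x) = count M (b, x))" by auto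
  also have "\<dots> \<longleftrightarrow> orbit_condition p q A lams mults Ns"
  proof
    assume inv_M: "\<forall>x \<in> ?S. \<forall>b. count M (b, ?\<pi> x) = count M (b, x)"
    show "orbit_condition p q A lams mults Ns"
      unfolding orbit_condition_def
    proof (intro ballI allI impI)
      fix X k l
      assume X: "X \<in> eigen_orbits p q A" and k: "k < length lams" and l: "l < length lams"
        and kX: "lams ! k \<in> X" and lX: "lams ! l \<in> X"
      from X obtain z where z: "z \<in> ?S" "X = eigen_orbit p q A z"
        by (auto simp: eigen_orbits_def)
      have U_X: "count ?U x = count ?U z" if "x \<in> X" for x
        using eigen_orbit_invariant[of A p q "count ?U"] perm(1) mult z that by blast
      have "count M (b, x) = count M (b, z)" if "x \<in> X" for x b
        using eigen_orbit_invariant[of A p q "\<lambda>x. count M (b, x)"] perm(1) inv_M z that by blast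
      then have "count (mset (f k)) b = count (mset (f l)) b" for b
        using kX lX count_M[OF k] count_M[OF l] by metis
      then have "mset (f k) = mset (f l)" by (rule multiset_eqI)
      then have "eq_up_to_block_order (Ns ! k) (Ns ! l)"
        unfolding eq_up_to_block_order_def using f0 Ns k l by metis
      moreover have "orbit_multiplicity A X = count ?U z"
        using kX U_X by (rule orbit_multiplicity_eqI)
      ultimately show "mults ! k = orbit_multiplicity A X \<and> mults ! l = orbit_multiplicity A X \<and>
          eq_up_to_block_order (Ns ! k) (Ns ! l)"
        using U_X kX lX k l by (simp add: mults)
    qed
  next
    assume cond: "orbit_condition p q A lams mults Ns"
    show "\<forall>x \<in> ?S. \<forall>b. count M (b, ?\<pi> x) = count M (b, x)"
    proof (intro ballI allI)
      fix x b assume x: "x \<in> ?S"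
      obtain k where k: "k < length lams" "lams ! k = x" using x lams by (metis in_set_conv_nth)
      obtain l where l: "l < length lams" "lams ! l = ?\<pi> x"
        using perm(1)[OF x] lams by (metis in_set_conv_nth)
      \<comment> \<open>Both \<open>x\<close> and its image lie in the orbit of \<open>x\<close>, so
        the orbit condition compares their nilpotent parts.\<close>
      have "eq_up_to_block_order (Ns ! k) (Ns ! l)"
        using cond x k l eigen_orbit_self[OF x, of p q] eigen_perm_in_orbit[OF perm(1)[OF x]]
        unfolding orbit_condition_def eigen_orbits_def by (metis imageI)
      then obtain bs bs' where bs: "0 \<notin> set bs" "0 \<notin> set bs'" "mset bs = mset bs'"
        "nilpotent_jordan (f k) = nilpotent_jordan bs" "nilpotent_jordan (f l) = nilpotent_jordan bs'"
        using Ns k(1) l(1) by (auto simp: eq_up_to_block_order_def)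
      have "mset (f k) = mset (f l)"
        using nilpotent_jordan_inject[OF f0[OF k(1)] bs(1,4)]
          nilpotent_jordan_inject[OF f0[OF l(1)] bs(2,5)] bs(3) by simp
      then show "count M (b, ?\<pi> x) = count M (b, x)"
        using count_M[OF k(1)] count_M[OF l(1)] k l by simp
    qed
  qed
  finally show ?thesis .
qed

subsection \<open>Singular matrices\<close>

lemma ex_jordan_nf:
  fixes A :: "complex mat"
  assumes "A \<in> carrier_mat n n"
  shows "\<exists>as. jordan_nf A as"
  using char_poly_factorized[OF assms] jordan_nf_exists[OF assms] by blast

lemma zero_mat_conv_jordan_matrix:
  "(0\<^sub>m k k :: 'a :: {zero,one} mat) = jordan_matrix (replicate k (1, 0))"
proof (induction k)
  case 0
  then show ?case by (auto simp: jordan_matrix_def)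
next
  case (Suc k)
  have "jordan_matrix (replicate (Suc k) (1, 0 :: 'a)) = four_block_mat (jordan_block 1 0) (0\<^sub>m 1 k) (0\<^sub>m k 1) (0\<^sub>m k k)"
    by (simp add: jordan_matrix_Cons Suc[simplified, symmetric] sum_list_replicate)
  also have "\<dots> = 0\<^sub>m (Suc k) (Suc k)" by (rule eq_matI) auto
  finally show ?case by simp
qed

lemma jordan_matrix_pow_eq_zero:
  assumes "\<And>s a. (s, a) \<in> set as \<Longrightarrow> a = (0 :: 'a :: field) \<and> s \<le> r"
  shows "jordan_matrix as ^\<^sub>m r = 0\<^sub>m (sum_list (map fst as)) (sum_list (map fst as))"
  unfolding jordan_matrix_pow using assms
proof (induction as)
  case (Cons sa as)
  obtain s where sa: "sa = (s, 0)" and s: "s \<le> r" using Cons.prems by (metis list.set_intros(1) surj_pair)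
  have "jordan_block s (0 :: 'a) ^\<^sub>m r = 0\<^sub>m s s"
    unfolding jordan_block_zero_pow using s by (intro eq_matI) auto
  moreover have "diag_block_mat (map (\<lambda>(s, a). jordan_block s a ^\<^sub>m r) as)
      = 0\<^sub>m (sum_list (map fst as)) (sum_list (map fst as))"
    using Cons.prems by (intro Cons.IH) auto
  ultimately show ?case by (simp add: sa)
qed auto

text \<open>Both sides are the dimension of the kernel of \<open>A ^\<^sub>m r\<close>. Similarity
  preserves the left side, and the right side can be read off the Jordan blocks of
  \<open>A\<close>.\<close>

lemma dim_gen_eigenspace_pow_zero:
  fixes A :: "'a :: field mat"
  assumes A: "A \<in> carrier_mat n n"
  shows "dim_gen_eigenspace (A ^\<^sub>m r) 0 1 = dim_gen_eigenspace A 0 r"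
proof -
  have char: "char_matrix B 0 = B" if "B \<in> carrier_mat n n" for B :: "'a mat"
    using that by (intro eq_matI) (auto simp: char_matrix_def)
  have "A ^\<^sub>m r \<in> carrier_mat n n" using A by simp
  then show ?thesis using A by (simp add: dim_gen_eigenspace_def char)
qed

text \<open>The summands compare termwise, so equal sums force \<open>min a x = min b x\<close> for
  each \<open>x\<close>, which with \<open>a < b\<close> means \<open>x \<le> a\<close>.\<close>

lemma sum_list_min_eq_imp_le:
  fixes xs :: "nat list"
  assumes "(\<Sum>x\<leftarrow>xs. min a x) = (\<Sum>x\<leftarrow>xs. min b x)" "a < b" "x \<in> set xs"
  shows "x \<le> a"
  using assms
proof (induction xs)
  case (Cons y xs)
  have "(\<Sum>x\<leftarrow>xs. min a x) \<le> (\<Sum>x\<leftarrow>xs. min b x)"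
    using Cons.prems(2) by (intro sum_list_mono) auto
  moreover have "min a y \<le> min b y" using Cons.prems(2) by auto
  ultimately have "min a y = min b y" "(\<Sum>x\<leftarrow>xs. min a x) = (\<Sum>x\<leftarrow>xs. min b x)"
    using Cons.prems(1) by auto
  then show ?case using Cons by (auto split: if_splits simp: min_def)
qed simp

lemma jordan_nf_pow_zero_block:
  fixes A :: "'a :: field_char_0 mat"
  assumes sim: "similar_mat A (diag_block_mat [A', N])"
    and A': "A' \<in> carrier_mat m m" and N: "N \<in> carrier_mat k k" and Nr: "N ^\<^sub>m r = 0\<^sub>m k k"
    and jnf: "jordan_nf (A' ^\<^sub>m r) as"
  shows "jordan_nf (A ^\<^sub>m r) (as @ replicate k (1, 0))"
proof -
  have "similar_mat (A ^\<^sub>m r) (diag_block_mat [A', N] ^\<^sub>m r)"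
    using sim similar_mat_wit_pow unfolding similar_mat_def by blast
  also have "diag_block_mat [A', N] ^\<^sub>m r = diag_block_mat [A' ^\<^sub>m r, 0\<^sub>m k k]"
    using A' N Nr by (subst diag_block_pow_mat) auto
  finally have sim_r: "similar_mat (A ^\<^sub>m r) (diag_block_mat [A' ^\<^sub>m r, 0\<^sub>m k k])" .
  have "jordan_nf (0\<^sub>m k k :: 'a mat) (replicate k (1, 0))"
    unfolding jordan_nf_def zero_mat_conv_jordan_matrix
    using similar_mat_refl[OF jordan_matrix_carrier] by auto
  then have "jordan_nf (diag_block_mat (map fst [(A' ^\<^sub>m r, as), (0\<^sub>m k k, replicate k (1, 0))]))
      (concat (map snd [(A' ^\<^sub>m r, as), (0\<^sub>m k k, replicate k (1, 0))]))"
    using jnf by (intro jordan_nf_diag_block_mat) auto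
  then show ?thesis
    using sim_r similar_mat_trans unfolding jordan_nf_def list.map fst_conv snd_conv concat.simps
      append_Nil2 by blast
qed

text \<open>Both powers acquire the same \<open>k\<close> zero blocks of size 1, which cancel when
  the block multisets are compared.\<close>

lemma similar_mat_pow_iff_invertible_part:
  fixes A :: "complex mat"
  assumes sim: "similar_mat A (diag_block_mat [A', N])"
    and A': "A' \<in> carrier_mat m m" and N: "N \<in> carrier_mat k k"
    and "N ^\<^sub>m r = 0\<^sub>m k k" "N ^\<^sub>m s = 0\<^sub>m k k"
  shows "similar_mat (A ^\<^sub>m r) (A ^\<^sub>m s) \<longleftrightarrow> similar_mat (A' ^\<^sub>m r) (A' ^\<^sub>m s)"
proof -
  obtain as bs where jnf: "jordan_nf (A' ^\<^sub>m r) as" "jordan_nf (A' ^\<^sub>m s) bs"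
    using ex_jordan_nf[of "A' ^\<^sub>m r" m] ex_jordan_nf[of "A' ^\<^sub>m s" m] A' by auto
  have "jordan_nf (A ^\<^sub>m r) (as @ replicate k (1, 0))" "jordan_nf (A ^\<^sub>m s) (bs @ replicate k (1, 0))"
    using jordan_nf_pow_zero_block assms jnf by blast+
  from similar_mat_iff_jordan_nf_mset[OF this] similar_mat_iff_jordan_nf_mset[OF jnf]
  show ?thesis by simp
qed

text \<open>Nonzero exponents fix 0, so \<open>V\<close> contributes equally to both sides and
  cancels.\<close>

lemma mset_powi_cancel_zeros:
  assumes "mset_powi (U + V) p = mset_powi (U + V) q" "p \<noteq> 0" "q \<noteq> 0" "set_mset V \<subseteq> {0}"
  shows "mset_powi U p = mset_powi U q"
proof -
  have "mset_powi V p = mset_powi V q"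
    using assms(2-4) unfolding mset_powi_def by (intro image_mset_cong) auto
  then show ?thesis using assms(1) by (simp add: mset_powi_def)
qed

text \<open>The Jordan blocks are separated into those with nonzero and those with zero eigenvalue.
  If the first list is empty, \<open>A'\<close> is the 0 by 0 matrix and
  \<open>k = n\<close>.\<close>

lemma fitting_decomposition:
  fixes A :: "complex mat"
  assumes A: "A \<in> carrier_mat n n" and sing: "\<not> invertible_mat A"
    and p: "1 \<le> p" and pq: "p < q"
    and eq: "mset_powi (eigenvalue_mset A) p = mset_powi (eigenvalue_mset A) q"
    and sim: "similar_mat (mat_powi A p) (mat_powi A q)"
  obtains k P Q A' N where "1 \<le> k" "k \<le> n" "A' \<in> carrier_mat (n - k) (n - k)" "invertible_mat A'"
    "N \<in> carrier_mat k k" "similar_mat_wit A (diag_block_mat [A', N]) P Q"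
    "mat_powi N p = 0\<^sub>m k k"
    "mset_powi (eigenvalue_mset A') p = mset_powi (eigenvalue_mset A') q"
proof -
  obtain as where jnf: "jordan_nf A as" using ex_jordan_nf[OF A] by blast
  define as1 as2 where "as1 = filter (\<lambda>(s, a). a \<noteq> 0) as" and "as2 = filter (\<lambda>(s, a). a = 0) as"
  let ?A = "jordan_matrix as1" and ?N = "jordan_matrix as2"
  let ?m = "sum_list (map fst as1)" and ?k = "sum_list (map fst as2)"
  have split: "mset as = mset (as1 @ as2)"
    unfolding as1_def as2_def by (induction as) auto
  have nz: "0 \<notin> fst ` set as" using jnf by (simp add: jordan_nf_def)
  have "similar_mat A (jordan_matrix (as1 @ as2))"
    using jnf similar_mat_jordan_matrix_mset[OF split] similar_mat_trans
    unfolding jordan_nf_def by blast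
  then have jnf12: "jordan_nf A (as1 @ as2)"
    using nz by (auto simp: jordan_nf_def as1_def as2_def)
  have jnf1: "jordan_nf ?A as1"
    using nz similar_mat_refl[OF jordan_matrix_carrier] by (auto simp: jordan_nf_def as1_def)
  have diag: "jordan_matrix (as1 @ as2) = diag_block_mat [?A, ?N]"
    using jordan_matrix_concat_diag_block_mat[of "[as1, as2]"] by simp
  then obtain P Q where wit: "similar_mat_wit A (diag_block_mat [?A, ?N]) P Q"
    using jnf12 unfolding jordan_nf_def similar_mat_def by auto
  have "jordan_matrix (as1 @ as2) \<in> carrier_mat n n"
    using similar_mat_witD2(5)[OF A wit] diag by simp
  then have n: "n = ?m + ?k" by auto
  \<comment> \<open>Singularity supplies a zero block of positive size, whence
    \<open>1 \<le> k\<close>.\<close>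
  have "0 \<in> spectrum A" using sing invertible_mat_iff_zero_notin_spectrum[OF A] by simp
  then obtain s where s: "(s, 0) \<in> set as2"
    unfolding spectrum_jordan_nf[OF A jnf] by (auto simp: as2_def)
  then have "s \<noteq> 0" using nz by (force simp: as2_def)
  moreover have "s \<le> ?k" using s by (force intro: member_le_sum_list)
  ultimately have k: "1 \<le> ?k" by simp
  have inv: "invertible_mat ?A"
    using invertible_mat_iff_zero_notin_spectrum[OF jordan_matrix_carrier[of as1]]
      spectrum_jordan_nf[OF jordan_matrix_carrier jnf1] by (auto simp: as1_def)
  have powi: "mat_powi B p = B ^\<^sub>m nat p" "mat_powi B q = B ^\<^sub>m nat q" for B
    using p pq by (auto simp: mat_powi_def)
  have "dim_gen_eigenspace A 0 (nat p) = dim_gen_eigenspace A 0 (nat q)"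
    using dim_gen_eigenspace_similar[OF sim] dim_gen_eigenspace_pow_zero[OF A] by (metis powi)
  \<comment> \<open>A zero block of size \<open>s\<close> contributes \<open>min r s\<close> to the
    kernel dimension of the \<open>r\<close>-th power.\<close>
  then have "(\<Sum>s\<leftarrow>map fst as2. min (nat p) s) = (\<Sum>s\<leftarrow>map fst as2. min (nat q) s)"
    by (simp add: dim_gen_eigenspace[OF jnf] as2_def)
  then have "s \<le> nat p" if "(s, a) \<in> set as2" for s a
    using sum_list_min_eq_imp_le[of "nat p" "map fst as2" "nat q" s] p pq that by force
  then have "mat_powi ?N p = 0\<^sub>m ?k ?k"
    unfolding powi by (intro jordan_matrix_pow_eq_zero) (auto simp: as2_def)
  moreover have "mset_powi (eigenvalue_mset ?A) p = mset_powi (eigenvalue_mset ?A) q"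
  proof (rule mset_powi_cancel_zeros)
    let ?V = "\<Sum>(s, a)\<leftarrow>as2. replicate_mset s a"
    have "eigenvalue_mset A = eigenvalue_mset ?A + ?V"
      by (simp add: eigenvalue_mset_jordan_nf[OF jnf12] eigenvalue_mset_jordan_nf[OF jnf1])
    then show "mset_powi (eigenvalue_mset ?A + ?V) p = mset_powi (eigenvalue_mset ?A + ?V) q"
      using eq by simp
    have "set_mset (\<Sum>(s, a)\<leftarrow>bs. replicate_mset s a) \<subseteq> snd ` set bs" for bs :: "(nat \<times> complex) list"
      by (induction bs) (auto split: if_splits)
    from this[of as2] show "set_mset ?V \<subseteq> {0}" by (auto simp: as2_def)
  qed (use p pq in auto)
  ultimately show ?thesis
    using that[of ?k ?A ?N P Q] k n inv wit by simp
qed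

lemma similar_mat_powi_singular_iff:
  assumes cop: "coprime p q" and pq2: "\<bar>p\<bar> + \<bar>q\<bar> > 2"
    and A: "A \<in> carrier_mat n n" and sing: "\<not> invertible_mat A"
    and p: "1 \<le> p" and pq: "p < q"
    and eq: "mset_powi (eigenvalue_mset A) p = mset_powi (eigenvalue_mset A) q"
  shows "similar_mat (mat_powi A p) (mat_powi A q) \<longleftrightarrow>
    (\<exists>k P Q A' N. 1 \<le> k \<and> k \<le> n \<and>
       A' \<in> carrier_mat (n - k) (n - k) \<and> invertible_mat A' \<and>
       N \<in> carrier_mat k k \<and>
       similar_mat_wit A (diag_block_mat [A', N]) P Q \<and>
       mat_powi N p = 0\<^sub>m k k \<and>
       mset_powi (eigenvalue_mset A') p = mset_powi (eigenvalue_mset A') q \<and>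
       (\<exists>lams mults Ns P' Q'. grouped_jordan_form A' lams mults Ns P' Q' \<and>
          orbit_condition p q A' lams mults Ns))"
    (is "?sim \<longleftrightarrow> (\<exists>k P Q A' N. ?dec k P Q A' N)")
proof -
  have powi: "mat_powi B p = B ^\<^sub>m nat p" "mat_powi B q = B ^\<^sub>m nat q" for B
    using p pq by (auto simp: mat_powi_def)
  \<comment> \<open>As \<open>p < q\<close>, the \<open>q\<close>-th power of \<open>N\<close>
    vanishes too, so similarity of the powers depends on \<open>A'\<close> alone. Both directions
    then follow from the invertible case for \<open>A'\<close>.\<close>
  have reduce: "?sim \<longleftrightarrow> similar_mat (mat_powi A' p) (mat_powi A' q)"
    if A': "A' \<in> carrier_mat m m" and N: "N \<in> carrier_mat k k"
      and wit: "similar_mat_wit A (diag_block_mat [A', N]) P Q"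
      and zero: "mat_powi N p = 0\<^sub>m k k" for m k A' N P Q
  proof -
    have "N ^\<^sub>m (nat p + d) = 0\<^sub>m k k" for d
      by (induction d) (use N zero in \<open>simp_all add: powi\<close>)
    from this[of "nat q - nat p"] have "N ^\<^sub>m nat q = 0\<^sub>m k k" using pq by simp
    then show ?thesis
      using similar_mat_pow_iff_invertible_part[OF _ A' N, of A "nat p" "nat q"] wit zero
      unfolding powi similar_mat_def by blast
  qed
  show ?thesis
  proof
    assume sim: ?sim
    from fitting_decomposition[OF A sing p pq eq sim] obtain k P Q A' N
      where k: "1 \<le> k" "k \<le> n" and A': "A' \<in> carrier_mat (n - k) (n - k)" "invertible_mat A'"
        and N: "N \<in> carrier_mat k k" and wit: "similar_mat_wit A (diag_block_mat [A', N]) P Q"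
        and zero: "mat_powi N p = 0\<^sub>m k k"
        and eq': "mset_powi (eigenvalue_mset A') p = mset_powi (eigenvalue_mset A') q"
      by metis
    obtain lams mults Ns P' Q' where gr: "grouped_jordan_form A' lams mults Ns P' Q'"
      using ex_jordan_nf[OF A'(1)] ex_grouped_jordan_form[OF A'(1)] by metis
    have "orbit_condition p q A' lams mults Ns"
      using similar_mat_powi_iff_orbit_condition[OF cop pq2 A' eq' gr]
        reduce[OF A'(1) N wit zero] sim by simp
    with k A' N wit zero eq' gr have "?dec k P Q A' N" by blast
    then show "\<exists>k P Q A' N. ?dec k P Q A' N" by blast
  next
    assume "\<exists>k P Q A' N. ?dec k P Q A' N"
    then obtain k P Q A' N lams mults Ns P' Q'
      where A': "A' \<in> carrier_mat (n - k) (n - k)" "invertible_mat A'"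
        and N: "N \<in> carrier_mat k k" and wit: "similar_mat_wit A (diag_block_mat [A', N]) P Q"
        and zero: "mat_powi N p = 0\<^sub>m k k"
        and eq': "mset_powi (eigenvalue_mset A') p = mset_powi (eigenvalue_mset A') q"
        and gr: "grouped_jordan_form A' lams mults Ns P' Q'"
        and cond: "orbit_condition p q A' lams mults Ns"
      by blast
    show ?sim
      using similar_mat_powi_iff_orbit_condition[OF cop pq2 A' eq' gr]
        reduce[OF A'(1) N wit zero] cond by simp
  qed
qed

theorem theorem1:
  fixes p q :: int and n :: nat and A :: "complex mat"
  assumes "coprime p q"
    and "\<bar>p\<bar> + \<bar>q\<bar> > 2"
    and "n \<ge> 1"
    and "A \<in> carrier_mat n n"
    and "mset_powi (eigenvalue_mset A) p = mset_powi (eigenvalue_mset A) q"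
  shows "(invertible_mat A \<longrightarrow>
           (\<forall>lams mults Ns P Q. grouped_jordan_form A lams mults Ns P Q \<longrightarrow>
              (similar_mat (mat_powi A p) (mat_powi A q) \<longleftrightarrow>
               orbit_condition p q A lams mults Ns))) \<and>
         (\<not> invertible_mat A \<and> 1 \<le> p \<and> p < q \<longrightarrow>
           (similar_mat (mat_powi A p) (mat_powi A q) \<longleftrightarrow>
            (\<exists>k P Q A' N. 1 \<le> k \<and> k \<le> n \<and>
               A' \<in> carrier_mat (n - k) (n - k) \<and> invertible_mat A' \<and>
               N \<in> carrier_mat k k \<and>
               similar_mat_wit A (diag_block_mat [A', N]) P Q \<and>
               mat_powi N p = 0\<^sub>m k k \<and>
               mset_powi (eigenvalue_mset A') p = mset_powi (eigenvalue_mset A') q \<and>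
               (\<exists>lams mults Ns P' Q'. grouped_jordan_form A' lams mults Ns P' Q' \<and>
                  orbit_condition p q A' lams mults Ns))))"
  using similar_mat_powi_iff_orbit_condition[OF assms(1,2,4) _ assms(5)]
    similar_mat_powi_singular_iff[OF assms(1,2,4) _ _ _ assms(5)]
  by (intro conjI impI allI) simp_all

end
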